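(* Let $n\ge 1$ and let $K$ be the complete convex geometric graph on $n$ vertices. Then the edge set of $K$ cannot be partitioned into fewer than $n-1$ plane star-forests.
   Context: A geometric graph is a graph whose vertices are points in the plane, no three collinear, and whose edges are straight line segments between certain pairs of vertices. It is convex if its vertices are in convex position (they are the vertices of a convex polygon); the complete convex geometric graph on $n$ vertices has all $\binom n2$ segments as edges. A star is a graph consisting of a vertex together with some edges incident to it (a single vertex counts as a star). A star-forest is a graph every connected component of which is a star. A plane star-forest (in a geometric graph) is a star-forest whose edges (segments) pairwise do not cross. *)

theory Defs
  imports "HOL-Analysis.Analysis" "HOL-Library.Disjoint_Sets"
begin

definition all_pairs :: "'a set \<Rightarrow> 'a set set" where
  "all_pairs V = {{u, v} | u v. u \<in> V \<and> v \<in> V \<and> u \<noteq> v}"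

definition simple_graph :: "'a set \<Rightarrow> 'a set set \<Rightarrow> bool" where
  "simple_graph V E \<longleftrightarrow> finite V \<and> E \<subseteq> all_pairs V"

definition component_verts :: "'a set \<Rightarrow> 'a set set \<Rightarrow> 'a \<Rightarrow> 'a set" where
  "component_verts V E v = {w \<in> V. (v, w) \<in> {(x, y). {x, y} \<in> E}\<^sup>*}"

definition component_edges :: "'a set \<Rightarrow> 'a set set \<Rightarrow> 'a \<Rightarrow> 'a set set" where
  "component_edges V E v = {e \<in> E. e \<subseteq> component_verts V E v}"

definition is_star :: "'a set \<Rightarrow> 'a set set \<Rightarrow> bool" where
  "is_star V E \<longleftrightarrow> simple_graph V E \<and> (\<exists>c\<in>V. V = insert c (\<Union>E) \<and> (\<forall>e\<in>E. c \<in> e))"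

definition star_forest :: "'a set \<Rightarrow> 'a set set \<Rightarrow> bool" where
  "star_forest V E \<longleftrightarrow> simple_graph V E \<and>
     (\<forall>v\<in>V. is_star (component_verts V E v) (component_edges V E v))"

text \<open>A straight-line edge is represented by the set of its two endpoints.\<close>

definition geometric_graph :: "(real^2) set \<Rightarrow> (real^2) set set \<Rightarrow> bool" where
  "geometric_graph V E \<longleftrightarrow> simple_graph V E \<and>
     (\<forall>a\<in>V. \<forall>b\<in>V. \<forall>c\<in>V. a \<noteq> b \<and> a \<noteq> c \<and> b \<noteq> c \<longrightarrow> \<not> collinear {a, b, c})"

text \<open>The points of \<open>V\<close> are exactly the corners of the polygon they span. For at most two
  points the polygon is degenerate and the condition holds trivially.\<close>

definition convex_position :: "(real^2) set \<Rightarrow> bool" where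
  "convex_position V \<longleftrightarrow> {v. v extreme_point_of (convex hull V)} = V"

definition complete_convex_geometric_graph :: "(real^2) set \<Rightarrow> (real^2) set set \<Rightarrow> bool" where
  "complete_convex_geometric_graph V E \<longleftrightarrow>
     geometric_graph V E \<and> convex_position V \<and> E = all_pairs V"

text \<open>Sharing an endpoint is not a crossing. As no three vertices are collinear, two distinct
  edges meet outside a common endpoint only in a point interior to both.\<close>

definition edges_cross :: "(real^2) set \<Rightarrow> (real^2) set \<Rightarrow> bool" where
  "edges_cross e f \<longleftrightarrow> e \<noteq> f \<and>
     (\<exists>a b c d. e = {a, b} \<and> f = {c, d} \<and> open_segment a b \<inter> open_segment c d \<noteq> {})"

definition plane_star_forest :: "(real^2) set \<Rightarrow> (real^2) set set \<Rightarrow> bool" where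
  "plane_star_forest V F \<longleftrightarrow> geometric_graph V F \<and> star_forest V F \<and>
     (\<forall>e\<in>F. \<forall>f\<in>F. \<not> edges_cross e f)"

end

theory Submission imports Defs begin

text \<open>
  Regard the classes of the partition as colours of the edges. In a star-forest every edge has an endpoint of degree one;
  choose such an endpoint for every edge and call it the pivot. Number the vertices cyclically and
  rotate a chord \<open>(i, j)\<close> about its pivot: it moves to \<open>(i + 1, j)\<close> if \<open>j\<close> is the pivot and to
  \<open>(i, j + 1)\<close> otherwise. Chords met during half a turn pairwise cross or share an endpoint, and the
  endpoints that are left behind (the non-pivots) are distinct. Two chords of the same colour do not
  cross, so they share a vertex, which has degree at least two in that colour and so is the
  non-pivot of both. Hence the chords met have distinct colours.

  A half turn that starts at \<open>(a, b)\<close> has to end near \<open>(b, a + n)\<close>. A discrete intermediate value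
  argument either finds such a start or finds two neighbouring chords whose trajectories drift apart;
  in the latter case a rotation in the opposite direction, caught between the two, has the property.
\<close>

section \<open>Signed areas in the plane\<close>

text \<open>Twice the signed area of the triangle \<open>a b c\<close>, positive for a
  counterclockwise turn.\<close>

definition orient :: "real^2 \<Rightarrow> real^2 \<Rightarrow> real^2 \<Rightarrow> real" where
  "orient a b c = (b$1 - a$1) * (c$2 - a$2) - (b$2 - a$2) * (c$1 - a$1)"

lemma orient_0_imp_collinear:
  assumes "orient a b c = 0"
  shows "collinear {a, b, c}"
proof (cases "b = a")
  case False
  have "\<exists>k. c - a = k *\<^sub>R (b - a)"
  proof (cases "b$1 = a$1")
    case True
    with False have "b$2 \<noteq> a$2" by (auto simp: vec_eq_iff forall_2)
    with True assms show ?thesis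
      by (intro exI[of _ "(c$2 - a$2) / (b$2 - a$2)"]) (auto simp: vec_eq_iff forall_2 orient_def)
  next
    case False
    with assms show ?thesis
      by (intro exI[of _ "(c$1 - a$1) / (b$1 - a$1)"])
        (auto simp: vec_eq_iff forall_2 orient_def eq_divide_eq mult.commute)
  qed
  then have "collinear {0, b - a, c - a}" by (auto simp: collinear_lemma)
  then have "collinear {b, a, c}" by (subst collinear_3) auto
  then show ?thesis by (simp add: insert_commute)
qed simp

text \<open>The three signed areas cut off by \<open>p\<close>, divided by their sum, are the
  barycentric coordinates of \<open>p\<close>.\<close>

lemma in_triangle_if_orient_pos:
  assumes "orient a b p > 0" "orient a p c > 0" "orient b c p > 0"
  shows "p \<in> convex hull {a, b, c}"
proof -
  define s where "s = orient a b p + orient a p c + orient b c p"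
  have s: "s > 0" using assms by (simp add: s_def)
  have "s *\<^sub>R p = orient b c p *\<^sub>R a + orient a p c *\<^sub>R b + orient a b p *\<^sub>R c"
    unfolding vec_eq_iff forall_2 s_def orient_def by (simp, intro conjI; algebra)
  then have "p = (orient b c p / s) *\<^sub>R a + (orient a p c / s) *\<^sub>R b + (orient a b p / s) *\<^sub>R c"
    using s by (simp add: vec_eq_iff forall_2 field_simps)
  moreover have "orient b c p / s + orient a p c / s + orient a b p / s = 1"
    using s by (simp add: s_def add_divide_distrib[symmetric])
  ultimately show ?thesis
    unfolding convex_hull_3 using assms s
    by (intro CollectI exI[of _ "orient b c p / s"] exI[of _ "orient a p c / s"] exI[of _ "orient a b p / s"])
      simp
qed

text \<open>Either diagonal splits the quadrilateral into two triangles, so \<open>s\<close> is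
  twice its area. The ratio of \<open>orient a b d\<close> to \<open>s\<close> locates the
  intersection on the diagonal from \<open>a\<close> to \<open>c\<close>.\<close>

lemma diagonals_cross:
  assumes "orient a b c > 0" "orient a b d > 0" "orient a c d > 0" "orient b c d > 0"
  shows "open_segment a c \<inter> open_segment b d \<noteq> {}"
proof -
  define s where "s = orient a b c + orient a c d"
  have s: "s > 0" "s = orient a b d + orient b c d"
    using assms by (auto simp: s_def orient_def algebra_simps)
  define x where "x = (1 - orient a b d / s) *\<^sub>R a + (orient a b d / s) *\<^sub>R c"
  have "s *\<^sub>R a + orient a b d *\<^sub>R (c - a) = s *\<^sub>R b + orient a b c *\<^sub>R (d - b)"
    unfolding vec_eq_iff forall_2 s_def orient_def by (simp, intro conjI; algebra)
  then have "x = (1 - orient a b c / s) *\<^sub>R b + (orient a b c / s) *\<^sub>R d"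
    using s(1) by (simp add: x_def vec_eq_iff forall_2 field_simps)
  moreover have "0 < orient a b d / s" "orient a b d / s < 1" "0 < orient a b c / s" "orient a b c / s < 1"
    using assms s by (auto simp: s_def)
  moreover have "a \<noteq> c" "b \<noteq> d" using assms by (auto simp: orient_def)
  ultimately have "x \<in> open_segment a c" "x \<in> open_segment b d"
    unfolding in_segment x_def by blast+
  then show ?thesis by blast
qed

section \<open>Cyclic order of points in convex position\<close>

lemma convex_position_not_in_hull:
  assumes "convex_position V" "v \<in> V"
  shows "v \<notin> convex hull (V - {v})"
proof -
  have "v extreme_point_of (convex hull V)"
    using assms by (auto simp: convex_position_def)
  then have "convex (convex hull V - {v})"
    by (simp add: extreme_point_of_stillconvex)
  moreover have "V - {v} \<subseteq> convex hull V - {v}"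
    using hull_subset[of V convex] by blast
  ultimately have "convex hull (V - {v}) \<subseteq> convex hull V - {v}"
    by (simp add: hull_minimal)
  then show ?thesis by blast
qed

text \<open>The key is the slope as seen from a vertex \<open>p\<close>, in coordinates in which \<open>p\<close> is strictly
  the leftmost point.\<close>

lemma convex_position_key:
  fixes V :: "(real^2) set"
  assumes geo: "geometric_graph V E" and conv: "convex_position V"
  obtains key :: "real^2 \<Rightarrow> real" where "inj_on key V"
    "\<And>a b c. a \<in> V \<Longrightarrow> b \<in> V \<Longrightarrow> c \<in> V \<Longrightarrow> key a < key b \<Longrightarrow> key b < key c \<Longrightarrow> orient a b c > 0"
proof (cases "V = {}")
  case False
  then obtain p where p: "p \<in> V" by blast
  have fin: "finite V"
    and ncol: "\<And>a b c. a \<in> V \<Longrightarrow> b \<in> V \<Longrightarrow> c \<in> V \<Longrightarrow> a \<noteq> b \<Longrightarrow> a \<noteq> c \<Longrightarrow> b \<noteq> c \<Longrightarrow> \<not> collinear {a, b, c}"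
    using geo by (auto simp: geometric_graph_def simple_graph_def)
  have "closed (convex hull (V - {p}))"
    using fin by (simp add: compact_imp_closed finite_imp_compact_convex_hull)
  then obtain u \<beta> where u: "u \<bullet> p < \<beta>" "\<And>x. x \<in> convex hull (V - {p}) \<Longrightarrow> u \<bullet> x > \<beta>"
    using separating_hyperplane_closed_point[of "convex hull (V - {p})" p]
      convex_position_not_in_hull[OF conv p] by auto
  define den where "den = (\<lambda>x. u \<bullet> (x - p))"
  define num where "num = (\<lambda>x::real^2. u$1 * (x$2 - p$2) - u$2 * (x$1 - p$1))"
  define slope where "slope = (\<lambda>x. num x / den x)"
  have den: "den x > 0" if "x \<in> V" "x \<noteq> p" for x
    using u(1) u(2)[of x] hull_inc[of x "V - {p}" convex] that by (auto simp: den_def inner_diff_right)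
  \<comment> \<open>\<open>den\<close> and \<open>num\<close> are the components of
    \<open>x - p\<close> along \<open>u\<close> and along \<open>u\<close> turned by a right angle,
    so determinants get scaled by the squared length of \<open>u\<close>.\<close>
  have cramer: "den x * num y - num x * den y = (u \<bullet> u) * orient p x y" for x y
    unfolding den_def num_def orient_def inner_vec_def by (simp add: sum_2) algebra
  have slope_less: "slope x < slope y \<longleftrightarrow> orient p x y > 0"
    if "x \<in> V" "x \<noteq> p" "y \<in> V" "y \<noteq> p" for x y
  proof -
    have "u \<noteq> 0" using den[of x] that by (auto simp: den_def)
    then have "u \<bullet> u > 0" by simp
    have "slope x < slope y \<longleftrightarrow> den x * num y - num x * den y > 0"
      using den[of x] den[of y] that by (simp add: slope_def field_simps)
    also have "\<dots> \<longleftrightarrow> orient p x y > 0"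
      unfolding cramer using \<open>u \<bullet> u > 0\<close> by (metis mult_pos_pos zero_less_mult_pos)
    finally show ?thesis .
  qed
  define key where "key = (\<lambda>x. if x = p then Min (insert 0 (slope ` V)) - 1 else slope x)"
  have key_p: "key p < key x" if "x \<in> V" "x \<noteq> p" for x
  proof -
    have "Min (insert 0 (slope ` V)) \<le> slope x" using that fin by (intro Min_le) auto
    then show ?thesis using that by (simp add: key_def)
  qed
  have inj: "inj_on key V"
  proof (rule inj_onI, rule ccontr)
    fix x y assume xy: "x \<in> V" "y \<in> V" "key x = key y" "x \<noteq> y"
    then have np: "x \<noteq> p" "y \<noteq> p" using key_p[of x] key_p[of y] by auto
    then have "slope x = slope y" using xy by (simp add: key_def)
    then have "\<not> orient p x y > 0" "\<not> orient p y x > 0"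
      using slope_less[of x y] slope_less[of y x] xy np by auto
    then have "orient p x y = 0" by (simp add: orient_def algebra_simps)
    then show False using orient_0_imp_collinear ncol[of p x y] p xy np by blast
  qed
  show thesis
  proof (rule that[OF inj])
    fix a b c assume abc: "a \<in> V" "b \<in> V" "c \<in> V" "key a < key b" "key b < key c"
    have bp: "b \<noteq> p" "c \<noteq> p" using key_p abc by (metis order_less_asym order_less_irrefl)+
    then have pbc: "orient p b c > 0" using abc slope_less[of b c] by (simp add: key_def)
    show "orient a b c > 0"
    proof (cases "a = p")
      case False
      then have pab: "orient p a b > 0" using abc bp slope_less[of a b] by (simp add: key_def)
      have ne: "a \<noteq> b" "b \<noteq> c" "a \<noteq> c" using abc by auto
      \<comment> \<open>A clockwise triple would put \<open>b\<close> into the triangle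
        \<open>p a c\<close>, although \<open>b\<close> is an extreme point.\<close>
      show ?thesis
      proof (rule ccontr)
        assume "\<not> orient a b c > 0"
        moreover have "orient a b c \<noteq> 0"
          using orient_0_imp_collinear ncol[of a b c] abc ne by blast
        ultimately have "orient a c b > 0" by (simp add: orient_def algebra_simps)
        then have "b \<in> convex hull {p, a, c}" using in_triangle_if_orient_pos pab pbc by blast
        also have "\<dots> \<subseteq> convex hull (V - {b})"
          using p abc ne bp by (intro hull_mono) auto
        finally show False using convex_position_not_in_hull[OF conv abc(2)] by blast
      qed
    qed (use pbc in simp)
  qed
qed (use that in auto)

text \<open>Sorting by the key makes every increasing triple of indices counterclockwise, which
  supplies the four hypotheses of \<open>diagonals_cross\<close>.\<close>

lemma convex_position_enumeration:
  fixes V :: "(real^2) set"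
  assumes geo: "geometric_graph V E" and conv: "convex_position V"
  obtains v :: "nat \<Rightarrow> real^2" where "bij_betw v {..<card V} V"
    "\<And>i j k l. i < j \<Longrightarrow> j < k \<Longrightarrow> k < l \<Longrightarrow> l < card V \<Longrightarrow>
       open_segment (v i) (v k) \<inter> open_segment (v j) (v l) \<noteq> {}"
proof -
  have fin: "finite V" using geo by (simp add: geometric_graph_def simple_graph_def)
  obtain key :: "real^2 \<Rightarrow> real" where inj: "inj_on key V"
    and key: "\<And>a b c. a \<in> V \<Longrightarrow> b \<in> V \<Longrightarrow> c \<in> V \<Longrightarrow> key a < key b \<Longrightarrow> key b < key c \<Longrightarrow> orient a b c > 0"
    using convex_position_key[OF assms] by blast
  define xs where "xs = sorted_list_of_set (key ` V)"
  define v where "v = (\<lambda>i. the_inv_into V key (xs ! i))"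
  have len: "length xs = card V" using inj by (simp add: xs_def card_image)
  have set_xs: "set xs = key ` V" using fin by (simp add: xs_def)
  have vb: "bij_betw v {..<card V} V"
  proof -
    have "bij_betw ((!) xs) {..<card V} (key ` V)"
      by (rule bij_betw_nth) (simp_all add: len set_xs, simp add: xs_def)
    moreover have "bij_betw (the_inv_into V key) (key ` V) V"
      using inj by (intro bij_betw_the_inv_into) (simp add: bij_betw_def)
    ultimately have "bij_betw (the_inv_into V key \<circ> (!) xs) {..<card V} V"
      by (rule bij_betw_trans)
    then show ?thesis by (simp add: v_def comp_def)
  qed
  have vV: "v i \<in> V" if "i < card V" for i using bij_betwE[OF vb] that by blast
  have key_v: "key (v i) = xs ! i" if "i < card V" for i
    unfolding v_def using that inj set_xs len nth_mem[of i xs] by (intro f_the_inv_into_f) auto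
  have less: "key (v i) < key (v j)" if "i < j" "j < card V" for i j
  proof -
    have "sorted_wrt (<) xs" by (simp add: xs_def)
    then show ?thesis using that len by (auto simp: key_v sorted_wrt_iff_nth_less)
  qed
  have "orient (v i) (v j) (v k) > 0" if "i < j" "j < k" "k < card V" for i j k
    using that by (intro key vV less) auto
  then show thesis using that[OF vb] diagonals_cross by (meson less_trans)
qed

text \<open>A shift by a multiple of \<open>n\<close> brings \<open>i\<close> into the range from
  \<open>0\<close> to \<open>n - 1\<close>. Subtracting \<open>n\<close> from the indices beyond
  this range rotates the quadruple cyclically, which at most interchanges the two chords.\<close>

lemma cyclic_chords_cross:
  fixes v :: "nat \<Rightarrow> real^2" and n :: nat
  assumes cross: "\<And>i j k l. i < j \<Longrightarrow> j < k \<Longrightarrow> k < l \<Longrightarrow> l < n \<Longrightarrow>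
       open_segment (v i) (v k) \<inter> open_segment (v j) (v l) \<noteq> {}"
    and w: "\<And>i. w i = v (nat (i mod int n))"
    and "i < j" "j < k" "k < l" "l < i + int n"
  shows "open_segment (w i) (w k) \<inter> open_segment (w j) (w l) \<noteq> {}"
proof -
  have n: "int n > 0" using assms by linarith
  define q where "q = i div int n * int n"
  define i' j' k' l' where d: "i' = i - q" "j' = j - q" "k' = k - q" "l' = l - q"
  have w': "w (x - q) = w x" for x
    by (simp add: w q_def mod_diff_eq[symmetric] flip: mod_diff_right_eq)
  have wsh: "w (x - int n) = w x" for x by (simp add: w)
  have wn: "w x = v (nat x)" if "0 \<le> x" "x < int n" for x using that by (simp add: w)
  have i': "0 \<le> i'" "i' < int n"
    using n by (auto simp: d q_def minus_div_mult_eq_mod)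
  have ord: "i' < j'" "j' < k'" "k' < l'" "l' < i' + int n" using assms by (auto simp: d)
  have C: "open_segment (w a) (w c) \<inter> open_segment (w b) (w e) \<noteq> {}"
    if "0 \<le> a" "a < b" "b < c" "c < e" "e < int n" for a b c e
    using cross[of "nat a" "nat b" "nat c" "nat e"] that by (simp add: wn)
  have "open_segment (w i') (w k') \<inter> open_segment (w j') (w l') \<noteq> {}"
  proof -
    consider "l' < int n" | "k' < int n" "int n \<le> l'" | "j' < int n" "int n \<le> k'" | "int n \<le> j'"
      by linarith
    then show ?thesis
    proof cases
      case 1
      then show ?thesis using C i' ord by auto
    next
      case 2
      then show ?thesis using C[of "l' - int n" i' j' k'] i' ord
        by (simp add: wsh open_segment_commute Int_commute)
    next
      case 3
      then show ?thesis using C[of "k' - int n" "l' - int n" i' j'] i' ord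
        by (simp add: wsh open_segment_commute Int_commute)
    next
      case 4
      then show ?thesis using C[of "j' - int n" "k' - int n" "l' - int n" i'] i' ord
        by (simp add: wsh open_segment_commute Int_commute)
    qed
  qed
  then show ?thesis by (simp add: d w')
qed

section \<open>Rotating a chord through half a turn\<close>

text \<open>Here \<open>h i j\<close> says that \<open>j\<close> is the pivot of the chord \<open>(i, j)\<close>. The assumptions on the degenerate
  chords \<open>(i, i)\<close> and \<open>(i, i + n)\<close> keep the rotation inside the strip \<open>i \<le> j \<le> i + n\<close>.\<close>

lemma thrackle_from_choice:
  fixes n :: nat and h :: "int \<Rightarrow> int \<Rightarrow> bool"
  assumes n: "n \<ge> 2"
    and h0: "\<And>i. \<not> h i i"
    and hn: "\<And>i. h i (i + int n)"
  obtains I J :: "nat \<Rightarrow> int" and T :: "nat set"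
  where "finite T" "card T = n - 1"
    "\<And>t. t \<in> T \<Longrightarrow> I t < J t \<and> J t < I t + int n"
    "\<And>t u. t \<in> T \<Longrightarrow> u \<in> T \<Longrightarrow> t < u \<Longrightarrow> I t \<le> I u \<and> I u \<le> J t \<and> J t \<le> J u \<and> J u \<le> I t + int n"
    "inj_on (\<lambda>t. (if h (I t) (J t) then I t else J t) mod int n) T"
proof -
  note witness = that
  define N where "N = int n"
  define m where "m = n - 1"
  have m: "int m = N - 1" "N \<ge> 2" using n by (auto simp: m_def N_def)
  \<comment> \<open>After \<open>t\<close> steps from \<open>(-k, k)\<close> the chord is \<open>(X k t, t - X k t)\<close>.\<close>
  define X where "X = (\<lambda>k::int. rec_nat (-k) (\<lambda>t i. if h i (int t - i) then i + 1 else i))"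
  have X0: "X k 0 = -k" for k by (simp add: X_def)
  have XS: "X k (Suc t) = (if h (X k t) (int t - X k t) then X k t + 1 else X k t)" for k t
    by (simp add: X_def)
  have Xmono: "X k t \<le> X k u" if "t \<le> u" for k t u
    using that by (induction u rule: dec_induct) (auto simp: XS)
  have Xlip: "X k u - int u \<le> X k t - int t" if "t \<le> u" for k t u
    using that by (induction u rule: dec_induct) (auto simp: XS)
  have strip: "2 * X k t \<le> int t \<and> int t - 2 * X k t \<le> N" if "0 \<le> k" "2 * k \<le> N" for k t
  proof (induction t)
    case (Suc t)
    have "2 * X k t < int t" if "h (X k t) (int t - X k t)"
    proof (rule ccontr)
      assume "\<not> 2 * X k t < int t"
      with Suc have "int t - X k t = X k t" by linarith
      then show False using that h0 by metis
    qed
    moreover have "int t - 2 * X k t < N" if "\<not> h (X k t) (int t - X k t)"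
    proof (rule ccontr)
      assume "\<not> int t - 2 * X k t < N"
      with Suc have "int t - X k t = X k t + int n" by (simp add: N_def)
      then show False using that hn by metis
    qed
    ultimately show ?case using Suc by (auto simp: XS)
  qed (use that in \<open>simp add: X0\<close>)
  \<comment> \<open>Half a turn takes \<open>(-k, k)\<close> to \<open>(k, n - k)\<close>, with
    coordinate sum \<open>n\<close>. If \<open>G k\<close> is \<open>k\<close> or
    \<open>k - 1\<close>, the chord after \<open>n - 1\<close> steps is one unit move short of
    that.\<close>
  define G where "G = (\<lambda>k. X k m)"
  \<comment> \<open>The non-pivot, which is the endpoint that a step in either direction
    moves.\<close>
  define val where "val = (\<lambda>Y t. if h (Y t) (int t - Y t) then Y t else int t - Y t)"
  \<comment> \<open>First endpoints lie in \<open>[a, c]\<close> and second ones in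
    \<open>[c, a + N]\<close>, which gives the interleaving. Distinct values less than
    \<open>N\<close> apart are incongruent modulo \<open>N\<close>.\<close>
  have finish: thesis
    if T: "finite T" "card T = n - 1"
      and ne: "\<And>t. t \<in> T \<Longrightarrow> 2 * Y t < int t \<and> int t - 2 * Y t < N"
      and mono: "\<And>t u. t \<in> T \<Longrightarrow> u \<in> T \<Longrightarrow> t < u \<Longrightarrow> Y t \<le> Y u \<and> int t - Y t \<le> int u - Y u"
      and box: "\<And>t. t \<in> T \<Longrightarrow> Y t \<le> c \<and> c \<le> int t - Y t \<and> a \<le> Y t \<and> int t - Y t \<le> a + N"
      and inj: "\<And>t u. t \<in> T \<Longrightarrow> u \<in> T \<Longrightarrow> t < u \<Longrightarrow> val Y t \<noteq> val Y u \<and> \<bar>val Y t - val Y u\<bar> < N"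
    for T and Y :: "nat \<Rightarrow> int" and a c :: int
  proof (rule witness[of T Y "\<lambda>t. int t - Y t"])
    show "Y t < int t - Y t \<and> int t - Y t < Y t + int n" if "t \<in> T" for t
      using ne[OF that] by (simp add: N_def)
    show "Y t \<le> Y u \<and> Y u \<le> int t - Y t \<and> int t - Y t \<le> int u - Y u \<and> int u - Y u \<le> Y t + int n"
      if "t \<in> T" "u \<in> T" "t < u" for t u
      using mono[OF that] box[OF that(1)] box[OF that(2)] by (simp add: N_def)
    have neq: "val Y t mod N \<noteq> val Y u mod N" if tu: "t \<in> T" "u \<in> T" "t < u" for t u
    proof
      assume "val Y t mod N = val Y u mod N"
      then have "N dvd val Y t - val Y u" by (simp add: mod_eq_dvd_iff)
      moreover have "val Y t - val Y u \<noteq> 0" using inj[OF tu] by simp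
      ultimately have "N \<le> \<bar>val Y t - val Y u\<bar>"
        using dvd_imp_le_int[of "val Y t - val Y u" N] m(2) by simp
      then show False using inj[OF tu] by simp
    qed
    have "inj_on (\<lambda>t. val Y t mod N) T"
    proof (rule inj_onI, rule ccontr)
      fix t u assume tu: "t \<in> T" "u \<in> T" "val Y t mod N = val Y u mod N" "t \<noteq> u"
      then consider "t < u" | "u < t" by linarith
      then show False using neq[of t u] neq[of u t] tu by cases simp_all
    qed
    then show "inj_on (\<lambda>t. (if h (Y t) (int t - Y t) then Y t else int t - Y t) mod int n) T"
      by (simp add: val_def N_def)
  qed (use T in auto)

  have forward: thesis if k: "0 \<le> k" "2 * k \<le> N" and Gk: "G k = k \<or> G k = k - 1" for k
  proof -
    define Y where "Y = X k"
    have Y0: "Y 0 = -k" and Ym: "Y m = k \<or> Y m = k - 1"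
      using Gk by (auto simp: Y_def X0 G_def)
    have Yb: "-k \<le> Y t \<and> Y t \<le> Y m \<and> k \<le> int t - Y t \<and> int t - Y t \<le> int m - Y m" if "t \<le> m" for t
      using Xmono[of 0 t k] Xmono[of t m k] Xlip[of 0 t k] Xlip[of t m k] that Y0 by (simp add: Y_def)
    have Ym2: "Y m \<le> k" "int m - Y m \<le> N - k" using Ym m by auto
    have Ymono: "Y t \<le> Y u \<and> int t - Y t \<le> int u - Y u" if "t < u" for t u
      using Xmono[of t u k] Xlip[of t u k] that by (simp add: Y_def)
    have Ystep: "if h (Y t) (int t - Y t) then Y t < Y u else int t - Y t < int u - Y u" if "t < u" for t u
    proof (cases "h (Y t) (int t - Y t)")
      case True
      then show ?thesis using Xmono[of "Suc t" u k] that by (simp add: Y_def XS)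
    next
      case False
      then show ?thesis using Xlip[of "Suc t" u k] that by (simp add: Y_def XS)
    qed
    \<comment> \<open>An endpoint left behind before time \<open>m\<close> is strictly below the
      final one on its side. So the values lie in \<open>[-k, k)\<close> for first and in
      \<open>[k, N - k)\<close> for second endpoints, together \<open>N\<close> consecutive
      integers.\<close>
    have inj0: "val Y t \<noteq> val Y u \<and> \<bar>val Y t - val Y u\<bar> < N" if "t < u" "u < m" for t u
      using Ystep[of t u] Ystep[of t m] Ystep[of u m] Ymono[of t u] Yb[of t] Yb[of u] Ym2 that m
      unfolding val_def by (auto split: if_splits)
    have Yst: "2 * Y t \<le> int t \<and> int t - 2 * Y t \<le> N" for t
      using strip[OF k] by (simp add: Y_def)
    show thesis
    proof (cases "\<forall>t<m. 2 * Y t < int t \<and> int t - 2 * Y t < N")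
      case True
      show thesis
      proof (rule finish[of "{..<m}" Y k "-k"])
        show "Y t \<le> k \<and> k \<le> int t - Y t \<and> - k \<le> Y t \<and> int t - Y t \<le> - k + N" if "t \<in> {..<m}" for t
          using Yb[of t] Ym2 that by auto
      qed (use True Ymono inj0 in \<open>auto simp: m_def\<close>)
    next
      case False
      \<comment> \<open>A degenerate chord forces all other chords to share one vertex, so the last chord may be
        used in its place.\<close>
      then obtain q where q: "q < m" "2 * Y q = int q \<or> int q - 2 * Y q = N"
        using Yst by (metis linorder_not_less order_antisym)
      \<comment> \<open>In case \<open>a\<close>, earlier chords have second endpoint
        \<open>k\<close> and later ones first endpoint \<open>k\<close>. In case \<open>b\<close>,
        earlier chords have first endpoint \<open>-k\<close> and later ones second endpoint
        \<open>N - k\<close>, the same vertex modulo \<open>N\<close>.\<close>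
      consider (a) "Y q = k" "int q - Y q = k" | (b) "Y q = -k" "int q - Y q = N - k"
        using q Yb[of q] Ym2 by fastforce
      then show thesis
      proof cases
        case a
        have Yme: "Y m = k" using Ym Yb[of q] a q by auto
        show thesis
        proof (rule finish[of "{..m} - {q}" Y k "-k"])
          fix t assume t: "t \<in> {..m} - {q}"
          then show "Y t \<le> k \<and> k \<le> int t - Y t \<and> - k \<le> Y t \<and> int t - Y t \<le> - k + N"
            using Yb[of t] Ym2 by auto
          have "t < q \<or> q < t" using t by auto
          then show "2 * Y t < int t \<and> int t - 2 * Y t < N"
            using Ymono[of t q] Ymono[of q t] a Yb[of t] t Yme m k q by auto
        next
          fix t u assume tu: "t \<in> {..m} - {q}" "u \<in> {..m} - {q}" "t < u"
          show "val Y t \<noteq> val Y u \<and> \<bar>val Y t - val Y u\<bar> < N"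
          proof (cases "u = m")
            case True
            have "t < q \<or> q < t" using tu by auto
            then show ?thesis
              using Ystep[of t q] Ystep[of t m] Ymono[of t q] Ymono[of q t] Yb[of t] tu True a Yme m k q
              unfolding val_def by (auto split: if_splits)
          qed (use inj0 tu in auto)
        qed (use q n Ymono in \<open>auto simp: m_def\<close>)
      next
        case b
        have Yme: "Y m = k - 1" using Ym Yb[of q] b q m by auto
        show thesis
        proof (rule finish[of "{..m} - {q}" Y k "-k"])
          fix t assume t: "t \<in> {..m} - {q}"
          then show "Y t \<le> k \<and> k \<le> int t - Y t \<and> - k \<le> Y t \<and> int t - Y t \<le> - k + N"
            using Yb[of t] Ym2 by auto
          have "t < q \<or> q < t" using t by auto
          then show "2 * Y t < int t \<and> int t - 2 * Y t < N"
            using Ymono[of t q] Ymono[of q t] b Yb[of t] t Yme m k q by auto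
        next
          fix t u assume tu: "t \<in> {..m} - {q}" "u \<in> {..m} - {q}" "t < u"
          show "val Y t \<noteq> val Y u \<and> \<bar>val Y t - val Y u\<bar> < N"
          proof (cases "u = m")
            case True
            have "t < q \<or> q < t" using tu by auto
            then show ?thesis
              using Ystep[of t q] Ystep[of t m] Ymono[of t q] Ymono[of q t] Yb[of t] tu True b Yme m k q
              unfolding val_def by (auto split: if_splits)
          qed (use inj0 tu in auto)
        qed (use q n Ymono in \<open>auto simp: m_def\<close>)
      qed
    qed
  qed

  have backward: thesis if k: "0 \<le> k" "2 * (k + 1) \<le> N" and G1: "G (k + 1) < k" and G2: "k < G k" for k
  proof -
    \<comment> \<open>The walk runs back in time from \<open>(k, m - k)\<close>, whose first
      coordinate is strictly between those of the two forward walks at time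
      \<open>m\<close>.\<close>
    define W where "W = rec_nat k (\<lambda>s i. if h i (int (m - s) - i) then i - 1 else i)"
    define Z where "Z = (\<lambda>t. W (m - t))"
    have Zm: "Z m = k" by (simp add: Z_def W_def)
    have ZS: "Z t = (if h (Z (Suc t)) (int (Suc t) - Z (Suc t)) then Z (Suc t) - 1 else Z (Suc t))"
      if "t < m" for t
    proof -
      have "m - t = Suc (m - Suc t)" "m - (m - Suc t) = Suc t" using that by auto
      then show ?thesis by (simp add: Z_def W_def)
    qed
    \<comment> \<open>The backward walk may touch the two forward walks, but not cross them.\<close>
    define up where "up = (\<lambda>t. Z t < X k t \<or> Z t = X k t \<and> h (Z t) (int t - Z t))"
    define lo where "lo = (\<lambda>t. X (k + 1) t < Z t \<or> Z t = X (k + 1) t \<and> \<not> h (Z t) (int t - Z t))"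
    have inv: "up t \<and> lo t" if "t \<le> m" for t
      using that
    proof (induction t rule: inc_induct)
      case base
      then show ?case using G1 G2 by (simp add: up_def lo_def Zm G_def)
    next
      case (step t)
      \<comment> \<open>Equality with the forward walk can only arise where that walk advances its
        first endpoint, which is the value of \<open>h\<close> that \<open>up\<close> asks for;
        \<open>lo\<close> is dual.\<close>
      have "up t" using step ZS[of t] XS[of k t] unfolding up_def by (auto split: if_splits)
      moreover have "lo t"
      proof -
        have "X (k + 1) t \<le> Z t \<and> (Z t = X (k + 1) t \<longrightarrow> X (k + 1) (Suc t) = X (k + 1) t)"
          using step ZS[of t] XS[of "k + 1" t] unfolding lo_def by (auto split: if_splits)
        then show ?thesis using XS[of "k + 1" t] unfolding lo_def by (auto split: if_splits)
      qed
      ultimately show ?case by simp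
    qed
    \<comment> \<open>A degenerate chord would have to touch a forward walk, with a value of
      \<open>h\<close> excluded by \<open>h0\<close> or \<open>hn\<close>.\<close>
    have ne: "2 * Z t < int t \<and> int t - 2 * Z t < N" if "t \<le> m" for t
    proof -
      have s: "2 * X k t \<le> int t" "int t - 2 * X (k + 1) t \<le> N"
        using strip[of k t] strip[of "k + 1" t] k by auto
      have "2 * Z t < int t"
      proof (rule ccontr)
        assume "\<not> 2 * Z t < int t"
        with s inv[OF that] have "h (Z t) (int t - Z t)" "int t - Z t = Z t" by (auto simp: up_def)
        then show False using h0 by metis
      qed
      moreover have "int t - 2 * Z t < N"
      proof (rule ccontr)
        assume "\<not> int t - 2 * Z t < N"
        with s inv[OF that] have "\<not> h (Z t) (int t - Z t)" "int t - Z t = Z t + int n"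
          by (auto simp: lo_def N_def)
        then show False using hn by metis
      qed
      ultimately show ?thesis by simp
    qed
    have Z0: "-k - 1 \<le> Z 0" "Z 0 \<le> -k" using inv[of 0] by (auto simp: up_def lo_def X0)
    have Zmono: "Z t \<le> Z u \<and> int t - Z t \<le> int u - Z u" if "t \<le> u" "u \<le> m" for t u
      using that
    proof (induction t rule: inc_induct)
      case (step t)
      then show ?case using ZS[of t] by (auto split: if_splits)
    qed auto
    have Zstep: "if h (Z u) (int u - Z u) then Z t < Z u else int t - Z t < int u - Z u"
      if "t < u" "u \<le> m" for t u
    proof -
      have u: "Suc (u - 1) = u" using that by simp
      have le: "t \<le> u - 1" "u - 1 \<le> m" "u - 1 < m" using that by auto
      show ?thesis using Zmono[OF le(1,2)] ZS[OF le(3), unfolded u] that by (auto split: if_splits)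
    qed
    have Zb: "Z 0 \<le> Z t \<and> Z t \<le> k \<and> - Z 0 \<le> int t - Z t \<and> int t - Z t \<le> int m - k" if "t \<le> m" for t
      using Zmono[of 0 t] Zmono[of t m] that Zm by auto
    \<comment> \<open>Time \<open>0\<close> is omitted because the chord there is only arrived at.
      The endpoints left behind lie in \<open>[-k, k]\<close> or in
      \<open>[k + 1, N - k - 1]\<close>, again \<open>N\<close> consecutive integers.\<close>
    show thesis
    proof (rule finish[of "{1..m}" Z k "-k-1"])
      show "Z t \<le> k \<and> k \<le> int t - Z t \<and> - k - 1 \<le> Z t \<and> int t - Z t \<le> - k - 1 + N" if "t \<in> {1..m}" for t
        using Zb[of t] Z0 m that by auto
      show "val Z t \<noteq> val Z u \<and> \<bar>val Z t - val Z u\<bar> < N" if "t \<in> {1..m}" "u \<in> {1..m}" "t < u" for t u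
        using Zstep[of t u] Zstep[of 0 t] Zstep[of 0 u] Zmono[of t u] Zb[of t] Zb[of u] Z0 m that
        unfolding val_def by (auto split: if_splits)
    qed (use ne Zmono in \<open>auto simp: m_def\<close>)
  qed

  define K where "K = N div 2"
  have K: "0 \<le> K" "2 * K \<le> N" "N \<le> 2 * K + 1" using m(2) by (auto simp: K_def)
  have G0: "0 \<le> G 0" using Xmono[of 0 m 0] by (simp add: G_def X0)
  have GK: "G K \<le> K" using strip[OF K(1,2), of m] m K by (simp add: G_def)
  show thesis
  proof (cases "G K = K")
    case True
    then show thesis using forward K by blast
  next
    case False
    \<comment> \<open>Discrete intermediate value: \<open>G\<close> starts on or above the diagonal
      at \<open>0\<close> and is strictly below it at \<open>K\<close>.\<close>
    have "\<exists>k. 0 \<le> k \<and> k < K \<and> k \<le> G k \<and> G (k + 1) < k + 1"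
    proof (rule ccontr)
      assume no: "\<not> ?thesis"
      have "k \<le> K \<longrightarrow> k \<le> G k" if "0 \<le> k" for k
        using that
      proof (induction k rule: int_ge_induct)
        case (step i)
        then show ?case using no by force
      qed (use G0 in simp)
      then show False using K GK False by force
    qed
    then obtain k where k: "0 \<le> k" "k < K" "k \<le> G k" "G (k + 1) < k + 1" by blast
    show thesis
    \<comment> \<open>\<open>G (k + 1) = k\<close> is the second alternative of
      \<open>forward\<close> at \<open>k + 1\<close>. Otherwise \<open>G (k + 1) < k < G k\<close>,
      as \<open>backward\<close> requires.\<close>
    proof (cases "G k = k \<or> G (k + 1) = k")
      case True
      then show thesis using forward[of k] forward[of "k + 1"] k K by auto
    next
      case False
      then show thesis using backward[of k] k K by auto
    qed
  qed
qed

section \<open>Star-forests and the colouring argument\<close>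

text \<open>Every edge at \<open>a\<close> or \<open>b\<close> lies in their common component and so
  contains its centre \<open>c\<close>. As \<open>c\<close> is one of the two, any edge at the other
  one is \<open>{a, b}\<close>.\<close>

lemma star_forest_edge_has_leaf:
  assumes sf: "star_forest V F" and ab: "{a, b} \<in> F"
  shows "(\<forall>e\<in>F. a \<in> e \<longrightarrow> e = {a, b}) \<or> (\<forall>e\<in>F. b \<in> e \<longrightarrow> e = {a, b})"
proof -
  have F: "F \<subseteq> all_pairs V" using sf by (simp add: star_forest_def simple_graph_def)
  have pair: "e = {x, y}" if "e \<in> F" "x \<in> e" "y \<in> e" "x \<noteq> y" for e x y
    using F that by (auto simp: all_pairs_def)
  have "{a, b} \<in> all_pairs V" using F ab by blast
  then have aV: "a \<in> V" "a \<noteq> b" by (auto simp: all_pairs_def doubleton_eq_iff)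
  define R where "R = {(x, y). {x, y} \<in> F}"
  have comp: "e \<in> component_edges V F a" if e: "e \<in> F" "x \<in> e" and x: "(a, x) \<in> R\<^sup>*" for e x
  proof -
    have "y \<in> V \<and> (a, y) \<in> R\<^sup>*" if "y \<in> e" for y
    proof (cases "y = x")
      case False
      then have "e = {x, y}" using pair e \<open>y \<in> e\<close> by blast
      then have "(x, y) \<in> R" using e by (simp add: R_def)
      then show ?thesis using x e F \<open>y \<in> e\<close> by (auto simp: all_pairs_def intro: rtrancl_into_rtrancl)
    qed (use x e F in \<open>auto simp: all_pairs_def\<close>)
    then show ?thesis using e by (auto simp: component_edges_def component_verts_def R_def)
  qed
  obtain c where c: "\<forall>e\<in>component_edges V F a. c \<in> e"
    using sf aV by (auto simp: star_forest_def is_star_def)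
  have ca: "c \<in> e" if "e \<in> F" "a \<in> e" for e using c comp[of e a] that by blast
  have "(a, b) \<in> R\<^sup>*" using ab by (auto simp: R_def)
  then have cb: "c \<in> e" if "e \<in> F" "b \<in> e" for e using c comp[of e b] that by blast
  have "c = a \<or> c = b" using ca[OF ab] by auto
  then show ?thesis using ca cb pair aV by (metis insert_commute)
qed

theorem theorem1:
  fixes V :: "(real^2) set" and E :: "(real^2) set set" and n :: nat
  assumes "n \<ge> 1"
    and "complete_convex_geometric_graph V E"
    and "card V = n"
  shows "\<not> (\<exists>P. partition_on E P \<and> (\<forall>F\<in>P. plane_star_forest V F) \<and> card P < n - 1)"
proof
  assume "\<exists>P. partition_on E P \<and> (\<forall>F\<in>P. plane_star_forest V F) \<and> card P < n - 1"
  then obtain P where P: "partition_on E P" "\<And>F. F \<in> P \<Longrightarrow> plane_star_forest V F" "card P < n - 1"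
    by blast
  have geo: "geometric_graph V E" and fin: "finite V" and E: "E = all_pairs V"
    and conv: "convex_position V"
    using assms(2)
    by (auto simp: complete_convex_geometric_graph_def geometric_graph_def simple_graph_def)
  have "E \<subseteq> Pow V" by (auto simp: E all_pairs_def)
  then have "finite E" using fin finite_subset by blast
  then have finP: "finite P" using P(1) by (rule finite_elements)
  obtain v where v: "bij_betw v {..<n} V"
    and cross: "\<And>i j k l. i < j \<Longrightarrow> j < k \<Longrightarrow> k < l \<Longrightarrow> l < n \<Longrightarrow>
       open_segment (v i) (v k) \<inter> open_segment (v j) (v l) \<noteq> {}"
    using convex_position_enumeration[OF geo conv] unfolding assms(3) by blast
  have n: "n \<ge> 2" using P(3) by linarith
  define w where "w = (\<lambda>i. v (nat (i mod int n)))"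
  have wV: "w i \<in> V" for i
  proof -
    have "nat (i mod int n) \<in> {..<n}" using n by (simp add: nat_less_iff)
    then show ?thesis using bij_betwE[OF v] by (auto simp: w_def)
  qed
  have w_eq: "w i = w j \<longleftrightarrow> i mod int n = j mod int n" for i j
  proof
    assume "w i = w j"
    then have "nat (i mod int n) = nat (j mod int n)"
      using bij_betw_imp_inj_on[OF v] n by (simp add: w_def inj_on_eq_iff nat_less_iff)
    then show "i mod int n = j mod int n" using n by (simp add: eq_nat_nat_iff)
  qed (simp add: w_def)
  have w_neq: "w i \<noteq> w j" if "i < j" "j < i + int n" for i j
  proof
    assume "w i = w j"
    then have "int n dvd j - i" by (simp add: w_eq mod_eq_dvd_iff dvd_diff_commute)
    then show False using that zdvd_imp_le[of "int n" "j - i"] by simp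
  qed
  define colour where "colour = (\<lambda>e. SOME F. F \<in> P \<and> e \<in> F)"
  have colour: "colour e \<in> P \<and> e \<in> colour e" if "e \<in> E" for e
  proof -
    have "\<exists>F. F \<in> P \<and> e \<in> F" using P(1) that by (auto simp: partition_on_def)
    then show ?thesis unfolding colour_def by (rule someI_ex)
  qed
  define leaf where "leaf = (\<lambda>x e. x \<in> e \<and> (\<forall>f\<in>colour e. x \<in> f \<longrightarrow> f = e))"
  define pivot where "pivot = (\<lambda>e. SOME x. leaf x e)"
  have pivot: "leaf (pivot e) e" if eE: "e \<in> E" for e
  proof -
    obtain a b where e: "e = {a, b}" using eE by (auto simp: E all_pairs_def)
    have "star_forest V (colour e)" "{a, b} \<in> colour e"
      using P(2) colour[OF eE] by (auto simp: plane_star_forest_def e)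
    from star_forest_edge_has_leaf[OF this] have "leaf a e \<or> leaf b e"
      by (auto simp: leaf_def e)
    then show ?thesis unfolding pivot_def by (metis someI_ex)
  qed
  \<comment> \<open>The first two cases are degenerate chords with \<open>w i = w j\<close>; their
    values are those that the rotation demands.\<close>
  define h where "h = (\<lambda>i j. if i = j then False else if j = i + int n then True
      else pivot {w i, w j} = w j)"
  obtain I J :: "nat \<Rightarrow> int" and T where T: "finite T" "card T = n - 1"
    and IJ: "\<And>t. t \<in> T \<Longrightarrow> I t < J t \<and> J t < I t + int n"
    and chain: "\<And>t u. t \<in> T \<Longrightarrow> u \<in> T \<Longrightarrow> t < u \<Longrightarrow>
       I t \<le> I u \<and> I u \<le> J t \<and> J t \<le> J u \<and> J u \<le> I t + int n"
    and inj: "inj_on (\<lambda>t. (if h (I t) (J t) then I t else J t) mod int n) T"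
  proof (rule thrackle_from_choice[OF n, of h])
    show "\<not> h i i" "h i (i + int n)" for i using n by (auto simp: h_def)
  qed blast
  define edge where "edge = (\<lambda>t. {w (I t), w (J t)})"
  define centre where "centre = (\<lambda>t. w (if h (I t) (J t) then I t else J t))"
  have edge_E: "edge t \<in> E" if "t \<in> T" for t
    using wV w_neq[of "I t" "J t"] IJ[OF that] by (auto simp: edge_def E all_pairs_def)
  have centre_eq: "x = centre t" if "t \<in> T" "x \<in> edge t" "x \<noteq> pivot (edge t)" for t x
  proof -
    have "pivot (edge t) \<in> edge t" using pivot[OF edge_E[OF that(1)]] by (simp add: leaf_def)
    then show ?thesis using IJ[OF that(1)] that by (auto simp: edge_def centre_def h_def)
  qed
  have centre_edge: "centre t \<in> edge t \<and> centre t \<noteq> pivot (edge t)" if "t \<in> T" for t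
    using pivot[OF edge_E[OF that]] IJ[OF that] w_neq[of "I t" "J t"]
    by (auto simp: edge_def centre_def h_def)
  have centre_inj: "t = u" if "t \<in> T" "u \<in> T" "centre t = centre u" for t u
    using inj that by (auto simp: inj_on_def centre_def w_eq)
  have same: False if t: "t \<in> T" and u: "u \<in> T" and tu: "t < u"
    and col: "colour (edge t) = colour (edge u)" for t u
  proof -
    define F where "F = colour (edge t)"
    have F: "edge t \<in> F" "edge u \<in> F" "plane_star_forest V F"
      using colour[OF edge_E[OF t]] colour[OF edge_E[OF u]] col P(2) by (auto simp: F_def)
    have ne: "edge t \<noteq> edge u"
    proof
      assume eq: "edge t = edge u"
      then have "centre t = centre u" using centre_edge[OF t] centre_eq[OF u] by simp
      then show False using centre_inj t u tu by blast
    qed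
    have disj: "x \<notin> edge u" if "x \<in> edge t" for x
    proof
      assume xu: "x \<in> edge u"
      \<comment> \<open>The two edges are distinct, of one colour, and both contain
        \<open>x\<close>, so \<open>x\<close> is the centre of both.\<close>
      have "\<not> leaf x (edge t)" "\<not> leaf x (edge u)"
        using that xu ne F col by (auto simp: leaf_def F_def)
      then have "x = centre t" "x = centre u"
        using centre_eq[OF t that] centre_eq[OF u xu] pivot edge_E t u by metis+
      then show False using centre_inj t u tu by blast
    qed
    have "w (I t) \<noteq> w (I u)" "w (J t) \<noteq> w (I u)" "w (J t) \<noteq> w (J u)" "w (I t) \<noteq> w (J u)"
      using disj by (auto simp: edge_def)
    \<comment> \<open>Disjointness makes the chain strict; its last bound \<open>I t + n\<close>
      names the same vertex as \<open>I t\<close>.\<close>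
    moreover have "w (I t) = w (I t + int n)" by (simp add: w_eq)
    ultimately have "I t \<noteq> I u" "J t \<noteq> I u" "J t \<noteq> J u" "J u \<noteq> I t + int n"
      by metis+
    then have "I t < I u" "I u < J t" "J t < J u" "J u < I t + int n"
      using chain[OF t u tu] by auto
    then have "open_segment (w (I t)) (w (J t)) \<inter> open_segment (w (I u)) (w (J u)) \<noteq> {}"
      by (rule cyclic_chords_cross[where v = v and n = n, rotated 2]) (use cross in \<open>auto simp: w_def\<close>)
    then have "edges_cross (edge t) (edge u)"
      unfolding edges_cross_def edge_def using ne[unfolded edge_def] by blast
    then show False using F by (auto simp: plane_star_forest_def)
  qed
  have "inj_on (\<lambda>t. colour (edge t)) T"
  proof (rule inj_onI, rule ccontr)
    fix t u assume "t \<in> T" "u \<in> T" "colour (edge t) = colour (edge u)" "t \<noteq> u"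
    then show False using same[of t u] same[of u t] by (cases "t < u") auto
  qed
  moreover have "(\<lambda>t. colour (edge t)) ` T \<subseteq> P" using colour edge_E by blast
  ultimately have "card T \<le> card P" using finP card_inj_on_le by blast
  then show False using T P(3) by simp
qed

end
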